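(* Let $P\in\mathbb{R}^{n\times n}$ be the transition matrix of an ergodic (irreducible and aperiodic) Markov chain with strictly positive stationary distribution $\pi$, let $D_\pi=\operatorname{diag}(\pi_1,\dots,\pi_n)$ and $U_{\perp1}=I_n-\mathbf{1}\pi^\top$. Suppose that the chain is diagonalizable, i.e. $PU_{\perp1}$ is diagonalizable (over $\mathbb{C}$). Let $\rho=\rho\big(D_\pi^{1/2}PU_{\perp1}D_\pi^{-1/2}\big)$ be the spectral radius of $D_\pi^{1/2}PU_{\perp1}D_\pi^{-1/2}$, let $D_\pi^{1/2}PU_{\perp1}D_\pi^{-1/2}=SJ_{\perp1}S^{-1}$ be its Jordan canonical form decomposition, and let $\kappa(S)=\|S\|_{\ell^2(\mathbb{R}^n)}\|S^{-1}\|_{\ell^2(\mathbb{R}^n)}$ be the condition number of the similarity transformation. Then the chain exhibits discrete-time hypocoercivity with constants $\lambda=\rho$ and $C=\kappa(S)$; that is, $\kappa(S)<\infty$, $\rho\in(0,1)$, and for every integer $k\ge1$, $$\sup_{f\in\ell^2(\pi):\,\|f-\pi(f)\|_{\ell^2(\pi)}=1}\|P^kf-\pi(f)\|_{\ell^2(\pi)}\le\kappa(S)\,\rho^k.$$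
   Context: $P$ is row-stochastic, $\pi^\top P=\pi^\top$, $\pi_i>0$ for all $i$, $\sum_i\pi_i=1$; $\mathbf{1}$ is the all-ones column vector. $\ell^2(\pi)$ is the space of vectors $f=(f_1,\dots,f_n)$ with norm $\|f\|_{\ell^2(\pi)}=(\sum_i|f_i|^2\pi_i)^{1/2}$; $\pi(f)=\sum_i\pi_if_i$, also identified with the constant function $\pi(f)\mathbf{1}$. $S$ is an invertible (possibly complex) matrix, $J_{\perp1}$ is the Jordan form (diagonal under the diagonalizability hypothesis), and $\|\cdot\|_{\ell^2(\mathbb{R}^n)}$ is the Euclidean operator (spectral) norm. A Markov chain exhibits discrete-time hypocoercivity if there exist constants $C<\infty$ and $\lambda\in(0,1)$ such that $\sup_{f\in\ell^2(\pi):\,\|f-\pi(f)\|_{\ell^2(\pi)}=1}\|P^kf-\pi(f)\|_{\ell^2(\pi)}\le C\lambda^k$ for all $k$.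
   Formalization: If P = 1π^T (e.g. n = 2, all entries 1/2), then PU = 0 and ρ = 0, so ρ ∈ (0,1) fails; hence ρ > 0 and hypocoercivity with λ = ρ are claimed only for P ≠ 1π^T, while κ(S) < ∞, 0 ≤ ρ < 1 and the decay bound for every k ≥ 1 hold in all cases. *)

theory Defs
  imports
    "Jordan_Normal_Form.Spectral_Radius"
    "Jordan_Normal_Form.Jordan_Normal_Form_Uniqueness"
    "HOL-Library.Extended_Real"
begin

definition row_stochastic :: "nat \<Rightarrow> real mat \<Rightarrow> bool" where
  "row_stochastic n P \<longleftrightarrow> P \<in> carrier_mat n n \<and>
     (\<forall>i<n. \<forall>j<n. 0 \<le> P $$ (i, j)) \<and> (\<forall>i<n. (\<Sum>j<n. P $$ (i, j)) = 1)"

definition irreducible_chain :: "nat \<Rightarrow> real mat \<Rightarrow> bool" where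
  "irreducible_chain n P \<longleftrightarrow> (\<forall>i<n. \<forall>j<n. \<exists>k. 0 < (P ^\<^sub>m k) $$ (i, j))"

definition aperiodic_chain :: "nat \<Rightarrow> real mat \<Rightarrow> bool" where
  "aperiodic_chain n P \<longleftrightarrow> (\<forall>i<n. Gcd {k. 0 < k \<and> 0 < (P ^\<^sub>m k) $$ (i, i)} = 1)"

definition positive_stationary :: "nat \<Rightarrow> real mat \<Rightarrow> real vec \<Rightarrow> bool" where
  "positive_stationary n P \<pi> \<longleftrightarrow> \<pi> \<in> carrier_vec n \<and>
     (\<forall>i<n. 0 < \<pi> $ i) \<and> (\<Sum>i<n. \<pi> $ i) = 1 \<and> transpose_mat P *\<^sub>v \<pi> = \<pi>"

text \<open>The rank-one matrix \<open>1 \<pi>\<^sup>T\<close>, the projection \<open>U = I - 1 \<pi>\<^sup>T\<close>, and the matrix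
  \<open>D\<^sup>1\<^sup>/\<^sup>2 P U D\<^sup>-\<^sup>1\<^sup>/\<^sup>2\<close> with \<open>D = diag \<pi>\<close>.\<close>

definition ones_pi :: "nat \<Rightarrow> real vec \<Rightarrow> real mat" where
  "ones_pi n \<pi> = mat n n (\<lambda>(i, j). \<pi> $ j)"

definition U_perp :: "nat \<Rightarrow> real vec \<Rightarrow> real mat" where
  "U_perp n \<pi> = 1\<^sub>m n - ones_pi n \<pi>"

definition weighted_PU :: "nat \<Rightarrow> real mat \<Rightarrow> real vec \<Rightarrow> real mat" where
  "weighted_PU n P \<pi> =
     mat_diag n (\<lambda>i. sqrt (\<pi> $ i)) * (P * U_perp n \<pi>) * mat_diag n (\<lambda>i. 1 / sqrt (\<pi> $ i))"

abbreviation complex_mat :: "real mat \<Rightarrow> complex mat" where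
  "complex_mat \<equiv> map_mat complex_of_real"

definition diagonalizable :: "complex mat \<Rightarrow> bool" where
  "diagonalizable A \<longleftrightarrow> (\<exists>D. diagonal_mat D \<and> similar_mat A D)"

definition pi_mean :: "real vec \<Rightarrow> real vec \<Rightarrow> real vec" where
  "pi_mean \<pi> f = vec (dim_vec \<pi>) (\<lambda>_. \<Sum>i<dim_vec \<pi>. \<pi> $ i * f $ i)"

definition l2pi_norm :: "real vec \<Rightarrow> real vec \<Rightarrow> real" where
  "l2pi_norm \<pi> f = sqrt (\<Sum>i<dim_vec \<pi>. \<bar>f $ i\<bar>\<^sup>2 * \<pi> $ i)"

text \<open>Suprema are taken in the extended reals, so that finiteness is not built into the type
  and the supremum over the empty set (no admissible \<open>f\<close> when \<open>n = 1\<close>) is meaningful.\<close>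

definition l2pi_decay :: "real mat \<Rightarrow> real vec \<Rightarrow> nat \<Rightarrow> ereal" where
  "l2pi_decay P \<pi> k =
     (SUP f \<in> {f \<in> carrier_vec (dim_vec \<pi>). l2pi_norm \<pi> (f - pi_mean \<pi> f) = 1}.
        ereal (l2pi_norm \<pi> (P ^\<^sub>m k *\<^sub>v f - pi_mean \<pi> f)))"

definition hypocoercive_with :: "real mat \<Rightarrow> real vec \<Rightarrow> ereal \<Rightarrow> real \<Rightarrow> bool" where
  "hypocoercive_with P \<pi> C r \<longleftrightarrow>
     C < \<infinity> \<and> 0 < r \<and> r < 1 \<and> (\<forall>k. l2pi_decay P \<pi> k \<le> C * ereal (r ^ k))"

definition euclid_norm :: "complex vec \<Rightarrow> real" where
  "euclid_norm x = sqrt (\<Sum>i<dim_vec x. (cmod (x $ i))\<^sup>2)"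

definition spectral_norm :: "complex mat \<Rightarrow> ereal" where
  "spectral_norm A =
     (SUP x \<in> {x \<in> carrier_vec (dim_col A). euclid_norm x = 1}. ereal (euclid_norm (A *\<^sub>v x)))"

text \<open>Condition number of an invertible matrix \<open>S\<close> with inverse \<open>T\<close>.\<close>

definition cond_number :: "complex mat \<Rightarrow> complex mat \<Rightarrow> ereal" where
  "cond_number S T = spectral_norm S * spectral_norm T"

end

(* On mean-zero functions P agrees with P U, and conjugation by the diagonal matrix with entries
   sqrt (pi_i) turns the weighted norm into the Euclidean one, so decay is governed by the powers
   of M = D^(1/2) P U D^(-1/2). By uniqueness of the Jordan form, M = S J T with J diagonal, so
   M^k = S J^k T has norm at most kappa(S) rho^k. An eigenvector of M for an eigenvalue of modulus
   at least 1 would give a mean-zero eigenfunction of P; the maximum principle and ergodicity make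
   it constant, hence zero, so rho < 1. If rho = 0 then J = 0 and P is the projection 1 pi^T. *)
theory Submission
  imports Defs
begin

section \<open>Diagonalizable Jordan forms\<close>

lemma jordan_matrix_singletons:
  "jordan_matrix (map (Pair 1) as) = mat_diag (length as) ((!) as)"
proof (induction as)
  case Nil
  then show ?case by (auto simp: jordan_matrix_def mat_diag_def)
next
  case (Cons a as)
  then have "jordan_matrix (map (Pair 1) (a # as)) =
      four_block_mat (jordan_block 1 a) (0\<^sub>m 1 (length as)) (0\<^sub>m (length as) 1)
        (mat_diag (length as) ((!) as))"
    by (simp add: jordan_matrix_def Let_def mat_diag_def)
  also have "\<dots> = mat_diag (length (a # as)) ((!) (a # as))"
    by (rule eq_matI) (auto simp: mat_diag_def jordan_block_def nth_Cons split: nat.splits)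
  finally show ?case .
qed

lemma diagonal_mat_eq_jordan_matrix:
  assumes "D \<in> carrier_mat n n" "diagonal_mat D"
  shows "D = jordan_matrix (map (Pair 1) (diag_mat D))"
  unfolding jordan_matrix_singletons using assms
  by (intro eq_matI) (auto simp: mat_diag_def diag_mat_def diagonal_mat_def)

text \<open>A diagonal matrix is itself a Jordan matrix with all blocks of size one. Uniqueness of
  the Jordan form up to the order of blocks forces the same shape on \<open>n_as\<close>.\<close>

lemma jordan_nf_diagonalizable:
  assumes "jordan_nf A n_as" "diagonalizable A"
  shows "n_as = map (Pair 1) (map snd n_as)"
proof -
  from assms(2) obtain D where D: "diagonal_mat D" "similar_mat A D"
    by (auto simp: diagonalizable_def)
  obtain n where "D \<in> carrier_mat n n" using similar_matD[OF D(2)] by auto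
  then have "jordan_nf A (map (Pair 1) (diag_mat D))"
    unfolding jordan_nf_def using D(2) diagonal_mat_eq_jordan_matrix[OF _ D(1)] by force
  from jordan_nf_unique[OF assms(1) this] have "fst x = 1" if "x \<in> set n_as" for x
    using that by auto
  then show ?thesis by (intro nth_equalityI) (auto simp: prod_eq_iff)
qed

lemma diagonalizable_similar:
  assumes "similar_mat A B" "diagonalizable A"
  shows "diagonalizable B"
  using assms similar_mat_trans similar_mat_sym unfolding diagonalizable_def by blast

lemma mat_diag_pow: "mat_diag n f ^\<^sub>m k = mat_diag n (\<lambda>i. f i ^ k)"
  by (induction k) (simp_all add: carrier_matD[OF mat_diag_dim] power_Suc2 del: power_Suc)

text \<open>The characteristic polynomial is the product of the factors (X - b)^m over the blocks.
  \<open>jordan_nf\<close> excludes m = 0, so each block really contributes its root.\<close>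

lemma eigenvalue_jordan_nf:
  assumes "A \<in> carrier_mat n n" "jordan_nf A n_as" "(m, a) \<in> set n_as"
  shows "eigenvalue (A :: 'a :: field mat) a"
proof -
  have "m \<noteq> 0" using assms(2,3) by (force simp: jordan_nf_def)
  then have "0 \<in> set (map (\<lambda>(m, b). poly ([:- b, 1:] ^ m) a) n_as)"
    using assms(3) by (force simp: poly_power)
  then have "poly (char_poly A) a = 0"
    unfolding jordan_nf_char_poly[OF assms(2)] poly_prod_list
    by (simp add: prod_list_zero_iff o_def case_prod_unfold)
  then show ?thesis using eigenvalue_root_char_poly[OF assms(1)] by simp
qed

section \<open>Norms\<close>

lemma euclid_norm_nonneg: "0 \<le> euclid_norm x"
  by (simp add: euclid_norm_def sum_nonneg)

lemma euclid_norm_smult: "euclid_norm (c \<cdot>\<^sub>v x) = cmod c * euclid_norm x"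
  by (simp add: euclid_norm_def norm_mult power_mult_distrib sum_distrib_left[symmetric]
      real_sqrt_mult)

lemma euclid_norm_eq_0: "euclid_norm x = 0 \<Longrightarrow> x = 0\<^sub>v (dim_vec x)"
  by (auto simp: euclid_norm_def sum_nonneg_eq_0_iff)

lemma cmod_le_euclid_norm: "i < dim_vec x \<Longrightarrow> cmod (x $ i) \<le> euclid_norm x"
  unfolding euclid_norm_def
  by (rule real_le_rsqrt) (auto intro: member_le_sum)

text \<open>Entries of a unit vector have modulus at most 1. The bound is crude; it serves only to
  show that the spectral norm is finite.\<close>

lemma euclid_norm_le_sum_entries:
  assumes "x \<in> carrier_vec (dim_col A)" "euclid_norm x = 1"
  shows "euclid_norm (A *\<^sub>v x) \<le>
    sqrt (\<Sum>i<dim_row A. (\<Sum>j<dim_col A. cmod (A $$ (i, j)))\<^sup>2)"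
proof -
  have "cmod ((A *\<^sub>v x) $ i) \<le> (\<Sum>j<dim_col A. cmod (A $$ (i, j)))" if "i < dim_row A" for i
  proof -
    have "(A *\<^sub>v x) $ i = (\<Sum>j<dim_col A. A $$ (i, j) * x $ j)"
      using that assms(1) by (auto simp: scalar_prod_def lessThan_atLeast0)
    also have "cmod \<dots> \<le> (\<Sum>j<dim_col A. cmod (A $$ (i, j)))"
    proof (rule sum_norm_le)
      fix j assume "j \<in> {..<dim_col A}"
      then have "cmod (x $ j) \<le> 1"
        using cmod_le_euclid_norm[of j x] assms by auto
      then show "cmod (A $$ (i, j) * x $ j) \<le> cmod (A $$ (i, j))"
        by (simp add: norm_mult mult_left_le)
    qed
    finally show ?thesis .
  qed
  then show ?thesis
    unfolding euclid_norm_def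
    by (intro real_sqrt_le_mono) (auto intro!: sum_mono power_mono)
qed

text \<open>Replaces the extended-real supremum by a real operator norm. For \<open>0 < n\<close> a
  unit vector exists, so the supremum is not that of the empty set, which would be -\<infinity>; the
  entrywise bound excludes \<infinity>.\<close>

lemma spectral_norm_real:
  assumes "A \<in> carrier_mat m n" "0 < n"
  obtains s where "spectral_norm A = ereal s" "0 \<le> s"
    "\<And>x. x \<in> carrier_vec n \<Longrightarrow> euclid_norm (A *\<^sub>v x) \<le> s * euclid_norm x"
proof -
  define B where "B = {x \<in> carrier_vec n. euclid_norm x = 1}"
  define b where "b = sqrt (\<Sum>i<dim_row A. (\<Sum>j<dim_col A. cmod (A $$ (i, j)))\<^sup>2)"
  have A: "dim_col A = n" "dim_row A = m" using assms by auto
  have sn: "spectral_norm A = (SUP x\<in>B. ereal (euclid_norm (A *\<^sub>v x)))"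
    by (simp add: spectral_norm_def B_def A)
  have upper: "spectral_norm A \<le> ereal b"
    unfolding sn b_def
    by (rule SUP_least) (use euclid_norm_le_sum_entries[of _ A] in \<open>auto simp: B_def A\<close>)
  have lower: "ereal (euclid_norm (A *\<^sub>v x)) \<le> spectral_norm A" if "x \<in> B" for x
    unfolding sn by (rule SUP_upper[OF that])
  have "euclid_norm (unit_vec n 0) = 1"
    using assms(2) by (simp add: euclid_norm_def unit_vec_def if_distrib[of cmod]
        if_distrib[of "\<lambda>x. x\<^sup>2"] sum.If_cases cong: if_cong)
  then have "unit_vec n 0 \<in> B" by (simp add: B_def)
  from lower[OF this] have nonneg: "0 \<le> spectral_norm A"
    by (meson dual_order.trans ereal_less_eq(5) euclid_norm_nonneg)
  obtain s where s: "spectral_norm A = ereal s"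
    using upper nonneg by (cases "spectral_norm A") auto
  show ?thesis
  proof
    show "spectral_norm A = ereal s" by (rule s)
    show "0 \<le> s" using nonneg s by simp
    fix x :: "complex vec" assume x: "x \<in> carrier_vec n"
    show "euclid_norm (A *\<^sub>v x) \<le> s * euclid_norm x"
    proof (cases "euclid_norm x = 0")
      case True
      then have "x = 0\<^sub>v n" using euclid_norm_eq_0[of x] x by auto
      then have "A *\<^sub>v x = 0\<^sub>v m" using assms by (intro eq_vecI) auto
      then show ?thesis using True by (simp add: euclid_norm_def)
    next
      case False
      define c where "c = euclid_norm x"
      have c: "0 < c" using False euclid_norm_nonneg[of x] by (simp add: c_def)
      \<comment> \<open>Normalising \<open>x\<close> brings it into the unit sphere
        \<open>B\<close>; homogeneity then carries the bound back to \<open>x\<close>.\<close>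
      define y where "y = complex_of_real (1 / c) \<cdot>\<^sub>v x"
      have y: "y \<in> carrier_vec n" using x by (simp add: y_def)
      have "y \<in> B"
        using c x by (simp add: B_def y_def euclid_norm_smult norm_divide c_def[symmetric])
      from lower[OF this] have "euclid_norm (A *\<^sub>v y) \<le> s" using s by simp
      moreover have "A *\<^sub>v y = complex_of_real (1 / c) \<cdot>\<^sub>v (A *\<^sub>v x)"
        unfolding y_def using assms x by (intro mult_mat_vec)
      ultimately have "euclid_norm (A *\<^sub>v x) / c \<le> s"
        using c by (simp add: euclid_norm_smult norm_divide)
      then show ?thesis using c by (simp add: c_def[symmetric] field_simps)
    qed
  qed
qed

lemma euclid_norm_mat_diag_le:
  assumes "x \<in> carrier_vec n" "0 \<le> r" "\<And>i. i < n \<Longrightarrow> cmod (f i) \<le> r"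
  shows "euclid_norm (mat_diag n f *\<^sub>v x) \<le> r * euclid_norm x"
proof -
  have "(mat_diag n f *\<^sub>v x) $ i = f i * x $ i" if "i < n" for i
    using that assms(1) by (auto simp: mat_diag_def scalar_prod_def sum.remove[of _ i])
  moreover have "(cmod (f i * x $ i))\<^sup>2 \<le> r\<^sup>2 * (cmod (x $ i))\<^sup>2" if "i < n" for i
    using assms(3)[OF that] by (simp add: norm_mult power_mult_distrib power_mono mult_right_mono)
  ultimately have "euclid_norm (mat_diag n f *\<^sub>v x) \<le> sqrt (\<Sum>i<n. r\<^sup>2 * (cmod (x $ i))\<^sup>2)"
    unfolding euclid_norm_def
    by (intro real_sqrt_le_mono) (auto intro!: sum_mono simp: mat_diag_def)
  also have "\<dots> = r * euclid_norm x"
    using assms(1,2) by (simp add: euclid_norm_def sum_distrib_left[symmetric] real_sqrt_mult)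
  finally show ?thesis .
qed

section \<open>Peripheral eigenvectors of ergodic chains\<close>

lemma index_mult_mat_sum:
  assumes "A \<in> carrier_mat m n" "B \<in> carrier_mat n l" "i < m" "j < l"
  shows "(A * B) $$ (i, j) = (\<Sum>h<n. A $$ (i, h) * B $$ (h, j))"
  using assms by (auto simp: scalar_prod_def lessThan_atLeast0)

lemma index_mult_mat_vec_sum:
  assumes "A \<in> carrier_mat m n" "x \<in> carrier_vec n" "i < m"
  shows "(A *\<^sub>v x) $ i = (\<Sum>h<n. A $$ (i, h) * x $ h)"
  using assms by (auto simp: scalar_prod_def lessThan_atLeast0)

lemma row_stochastic_pow:
  assumes "row_stochastic n P"
  shows "row_stochastic n (P ^\<^sub>m k)"
proof (induction k)
  case 0
  have "P \<in> carrier_mat n n" using assms by (simp add: row_stochastic_def)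
  then show ?case by (auto simp: row_stochastic_def)
next
  case (Suc k)
  have P: "P \<in> carrier_mat n n" "P ^\<^sub>m k \<in> carrier_mat n n"
    using assms by (auto simp: row_stochastic_def)
  have entry: "(P ^\<^sub>m Suc k) $$ (i, j) = (\<Sum>h<n. (P ^\<^sub>m k) $$ (i, h) * P $$ (h, j))"
    if "i < n" "j < n" for i j
    using index_mult_mat_sum[OF P(2,1) that] by simp
  have "(\<Sum>j<n. (P ^\<^sub>m Suc k) $$ (i, j)) = 1" if i: "i < n" for i
  proof -
    have "(\<Sum>j<n. (P ^\<^sub>m Suc k) $$ (i, j)) =
        (\<Sum>j<n. \<Sum>h<n. (P ^\<^sub>m k) $$ (i, h) * P $$ (h, j))"
      using i by (intro sum.cong) (auto simp: entry simp del: pow_mat.simps)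
    also have "\<dots> = (\<Sum>h<n. (P ^\<^sub>m k) $$ (i, h) * (\<Sum>j<n. P $$ (h, j)))"
      by (subst sum.swap) (simp add: sum_distrib_left)
    also have "\<dots> = 1" using assms Suc i by (simp add: row_stochastic_def)
    finally show ?thesis .
  qed
  moreover have "0 \<le> (P ^\<^sub>m Suc k) $$ (i, j)" if "i < n" "j < n" for i j
    unfolding entry[OF that] using assms Suc that
    by (auto simp: row_stochastic_def intro!: sum_nonneg)
  ultimately show ?case using P(1) by (simp add: row_stochastic_def del: pow_mat.simps)
qed

text \<open>The eigenvalue equation is written entrywise, so that the real matrix can act on a
  complex function without being embedded.\<close>

lemma eigenfunction_pow:
  fixes v :: "nat \<Rightarrow> complex"
  assumes P: "P \<in> carrier_mat n n"
    and ev: "\<And>i. i < n \<Longrightarrow> (\<Sum>j<n. complex_of_real (P $$ (i, j)) * v j) = l * v i"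
    and i: "i < n"
  shows "(\<Sum>j<n. complex_of_real ((P ^\<^sub>m k) $$ (i, j)) * v j) = l ^ k * v i"
  using i
proof (induction k arbitrary: i)
  case 0
  have "(\<Sum>j<n. complex_of_real ((P ^\<^sub>m 0) $$ (i, j)) * v j) = (\<Sum>j<n. if i = j then v j else 0)"
    using P 0 by (intro sum.cong) auto
  then show ?case using 0 by simp
next
  case (Suc k)
  have "(\<Sum>j<n. complex_of_real ((P ^\<^sub>m Suc k) $$ (i, j)) * v j) =
      (\<Sum>j<n. \<Sum>h<n. complex_of_real ((P ^\<^sub>m k) $$ (i, h)) * (complex_of_real (P $$ (h, j)) * v j))"
    using Suc.prems P
    by (intro sum.cong)
      (auto simp: index_mult_mat_sum[OF pow_carrier_mat[OF P] P] sum_distrib_right mult.assoc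
        simp del: index_mult_mat)
  also have "\<dots> = (\<Sum>h<n. complex_of_real ((P ^\<^sub>m k) $$ (i, h)) * (l * v h))"
    by (subst sum.swap) (simp add: sum_distrib_left[symmetric] ev)
  also have "\<dots> = l * (\<Sum>h<n. complex_of_real ((P ^\<^sub>m k) $$ (i, h)) * v h)"
    by (simp add: sum_distrib_left mult.left_commute)
  finally show ?case using Suc by simp
qed

text \<open>Strict convexity of the disc: a point on the bounding circle is an average of points of
  the disc only if every point of positive weight equals it.\<close>

lemma convex_combination_extremal:
  fixes v :: "nat \<Rightarrow> complex" and p :: "nat \<Rightarrow> real"
  assumes p: "\<And>j. j < n \<Longrightarrow> 0 \<le> p j" "(\<Sum>j<n. p j) = 1"
    and le: "\<And>j. j < n \<Longrightarrow> cmod (v j) \<le> cmod w"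
    and avg: "(\<Sum>j<n. complex_of_real (p j) * v j) = w"
    and j: "j < n" "0 < p j"
  shows "v j = w"
proof -
  define m where "m = cmod w"
  have re_le: "Re (v h * cnj w) \<le> m\<^sup>2" if "h < n" for h
  proof -
    have "Re (v h * cnj w) \<le> cmod (v h) * cmod w"
      using complex_Re_le_cmod[of "v h * cnj w"] by (simp add: norm_mult)
    also have "\<dots> \<le> m\<^sup>2"
      using le[OF that] by (simp add: m_def power2_eq_square mult_right_mono)
    finally show ?thesis .
  qed
  have "(\<Sum>h<n. complex_of_real (p h) * v h) * cnj w = complex_of_real (m\<^sup>2)"
    unfolding avg m_def by (simp add: complex_norm_square[symmetric])
  then have "Re (\<Sum>h<n. complex_of_real (p h) * (v h * cnj w)) = m\<^sup>2"
    by (simp add: sum_distrib_right mult.assoc)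
  then have "(\<Sum>h<n. p h * Re (v h * cnj w)) = m\<^sup>2"
    by simp
  \<comment> \<open>All summands are nonnegative by \<open>re_le\<close>, so the vanishing sum makes
    each of them vanish, in particular the one with \<open>0 < p j\<close>.\<close>
  then have "(\<Sum>h<n. p h * (m\<^sup>2 - Re (v h * cnj w))) = 0"
    using p(2) by (simp add: right_diff_distrib sum_subtractf sum_distrib_right[symmetric])
  then have "p j * (m\<^sup>2 - Re (v j * cnj w)) = 0"
    using re_le p(1) j(1) by (subst (asm) sum_nonneg_eq_0_iff) (auto simp del: mult_eq_0_iff)
  then have re: "Re (v j * cnj w) = m\<^sup>2" using j(2) by simp
  \<comment> \<open>The cross term equals the squared modulus of \<open>w\<close> and
    \<open>v j\<close> is no larger than \<open>w\<close>, so the squared distance cannot be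
    positive.\<close>
  have "(cmod (v j - w))\<^sup>2 = (cmod (v j))\<^sup>2 - 2 * Re (v j * cnj w) + (cmod w)\<^sup>2"
    unfolding cmod_power2 by (simp add: power2_eq_square algebra_simps)
  also have "\<dots> \<le> 0"
    using le[OF j(1)] power_mono[of "cmod (v j)" m 2] re by (simp add: m_def)
  finally show ?thesis by simp
qed

text \<open>The multiplicative order of \<open>z\<close> divides every exponent in \<open>K\<close>,
  hence their gcd, so it is 1.\<close>

lemma power_eq_1_if_Gcd_eq_1:
  fixes z :: "'a :: field"
  assumes "\<And>k. k \<in> K \<Longrightarrow> 0 < k \<and> z ^ k = 1" "Gcd K = (1 :: nat)"
  shows "z = 1"
proof -
  \<comment> \<open>\<open>K\<close> is nonempty because the gcd of the empty set is 0.\<close>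
  obtain k0 where "k0 \<in> K" using assms(2) by fastforce
  then have ex: "\<exists>d. 0 < d \<and> z ^ d = 1" using assms(1) by blast
  define d where "d = (LEAST d. 0 < d \<and> z ^ d = 1)"
  have d: "0 < d" "z ^ d = 1" using LeastI_ex[OF ex] by (auto simp: d_def)
  have "d dvd k" if "k \<in> K" for k
  proof -
    have "z ^ k = z ^ (d * (k div d) + k mod d)" by simp
    also have "\<dots> = z ^ (k mod d)" unfolding power_add power_mult d(2) by simp
    finally have "z ^ (k mod d) = 1" using assms(1)[OF that] by simp
    moreover have "k mod d < d" using d(1) by simp
    ultimately have "k mod d = 0" using not_less_Least[of "k mod d" "\<lambda>d. 0 < d \<and> z ^ d = 1"]
      by (auto simp: d_def)
    then show ?thesis by auto
  qed
  then have "d dvd Gcd K" by (rule Gcd_greatest)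
  then show ?thesis using assms(2) d(2) by simp
qed

text \<open>At an index \<open>i\<close> of maximal modulus, \<open>l ^ k * v i\<close> is a convex combination of numbers of
  no larger modulus, so \<open>v j = l ^ k * v i\<close> whenever \<open>j\<close> is reachable from \<open>i\<close> in \<open>k\<close> steps.
  Taking \<open>j = i\<close>, aperiodicity forces \<open>l = 1\<close>; then irreducibility makes \<open>v\<close> constant.\<close>

lemma ergodic_peripheral_eigenfunction_constant:
  fixes v :: "nat \<Rightarrow> complex"
  assumes st: "row_stochastic n P" and irr: "irreducible_chain n P" and ap: "aperiodic_chain n P"
    and ev: "\<And>i. i < n \<Longrightarrow> (\<Sum>j<n. complex_of_real (P $$ (i, j)) * v j) = l * v i"
    and l: "1 \<le> cmod l"
  shows "\<exists>c. \<forall>j<n. v j = c"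
proof (cases "\<forall>j<n. v j = 0")
  case True
  then show ?thesis by blast
next
  case False
  define m where "m = Max ((\<lambda>j. cmod (v j)) ` {..<n})"
  have "{..<n} \<noteq> {}" using False by auto
  then have "m \<in> (\<lambda>j. cmod (v j)) ` {..<n}" unfolding m_def by (intro Max_in) auto
  then obtain i where i: "i < n" "m = cmod (v i)" by auto
  have le: "cmod (v j) \<le> cmod (v i)" if "j < n" for j
    unfolding i(2)[symmetric] m_def using that by (intro Max_ge) auto
  have vi: "v i \<noteq> 0" using False le by fastforce
  have P: "P \<in> carrier_mat n n" using st by (simp add: row_stochastic_def)
  have step: "v j = l ^ k * v i" if "j < n" "0 < (P ^\<^sub>m k) $$ (i, j)" for j k
  proof (rule convex_combination_extremal[where p = "\<lambda>j. (P ^\<^sub>m k) $$ (i, j)" and n = n])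
    show "0 \<le> (P ^\<^sub>m k) $$ (i, j)" if "j < n" for j
      using row_stochastic_pow[OF st, of k] i that by (simp add: row_stochastic_def)
    show "(\<Sum>j<n. (P ^\<^sub>m k) $$ (i, j)) = 1"
      using row_stochastic_pow[OF st, of k] i by (simp add: row_stochastic_def)
    \<comment> \<open>The assumption on \<open>cmod l\<close> enters here: multiplying
      \<open>v i\<close> by \<open>l ^ k\<close> does not shrink it, so moduli equal to 1 and above
      1 are treated together.\<close>
    show "cmod (v j) \<le> cmod (l ^ k * v i)" if "j < n" for j
    proof -
      have "cmod (v i) \<le> cmod l ^ k * cmod (v i)"
        using one_le_power[OF l, of k] mult_right_mono[of 1 "cmod l ^ k" "cmod (v i)"] by simp
      then show ?thesis using le[OF that] by (simp add: norm_mult norm_power)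
    qed
    show "(\<Sum>j<n. complex_of_real ((P ^\<^sub>m k) $$ (i, j)) * v j) = l ^ k * v i"
      using P ev i(1) by (rule eigenfunction_pow)
  qed (use that in auto)
  have "l = 1"
  proof (rule power_eq_1_if_Gcd_eq_1)
    show "Gcd {k. 0 < k \<and> 0 < (P ^\<^sub>m k) $$ (i, i)} = 1"
      using ap i(1) by (simp add: aperiodic_chain_def)
    show "0 < k \<and> l ^ k = 1" if "k \<in> {k. 0 < k \<and> 0 < (P ^\<^sub>m k) $$ (i, i)}" for k
      using that step[OF i(1), of k] vi by auto
  qed
  have "v j = v i" if j: "j < n" for j
  proof -
    obtain k where "0 < (P ^\<^sub>m k) $$ (i, j)"
      using irr i(1) j by (auto simp: irreducible_chain_def)
    from step[OF j this] show ?thesis using \<open>l = 1\<close> by simp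
  qed
  then show ?thesis by blast
qed

section \<open>The weighted matrix\<close>

locale stationary_chain =
  fixes n :: nat and P :: "real mat" and \<pi> :: "real vec"
  assumes stochastic: "row_stochastic n P"
    and stationary: "positive_stationary n P \<pi>"
begin

lemma P_carrier [simp]: "P \<in> carrier_mat n n"
  using stochastic by (simp add: row_stochastic_def)

lemma pi_dim [simp]: "dim_vec \<pi> = n"
  using stationary by (auto simp: positive_stationary_def)

lemma pi_pos: "i < n \<Longrightarrow> 0 < \<pi> $ i"
  using stationary by (simp add: positive_stationary_def)

text \<open>For \<open>n = 0\<close> the weights would sum to 0 instead of 1.\<close>

lemma n_pos: "0 < n"
  using stationary by (cases n) (auto simp: positive_stationary_def)

lemma sum_pi: "(\<Sum>i<n. \<pi> $ i) = 1"
  using stationary by (simp add: positive_stationary_def)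

lemma pi_invariant: "j < n \<Longrightarrow> (\<Sum>i<n. \<pi> $ i * P $$ (i, j)) = \<pi> $ j"
proof -
  assume j: "j < n"
  have "(transpose_mat P *\<^sub>v \<pi>) $ j = (\<Sum>i<n. transpose_mat P $$ (j, i) * \<pi> $ i)"
  proof (rule index_mult_mat_vec_sum)
    show "transpose_mat P \<in> carrier_mat n n" by simp
    show "\<pi> \<in> carrier_vec n" by (rule carrier_vecI) simp
  qed (rule j)
  moreover have "transpose_mat P *\<^sub>v \<pi> = \<pi>"
    using stationary by (simp add: positive_stationary_def)
  ultimately have "\<pi> $ j = (\<Sum>i<n. transpose_mat P $$ (j, i) * \<pi> $ i)" by simp
  also have "\<dots> = (\<Sum>i<n. \<pi> $ i * P $$ (i, j))"
    using j carrier_matD[OF P_carrier] by (intro sum.cong) (auto simp: mult.commute)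
  finally show ?thesis by simp
qed

section \<open>Entries, similarity and spectrum of the weighted matrix\<close>

lemma U_perp_carrier [simp]: "U_perp n \<pi> \<in> carrier_mat n n"
  unfolding U_perp_def ones_pi_def by (intro minus_carrier_mat mat_carrier)

lemma PU_carrier [simp]: "P * U_perp n \<pi> \<in> carrier_mat n n"
  by (rule mult_carrier_mat[OF P_carrier U_perp_carrier])

text \<open>Since the rows of \<open>P\<close> sum to 1, \<open>P\<close> fixes the rank-one matrix
  \<open>ones_pi n \<pi>\<close>, and only that matrix is subtracted.\<close>

lemma PU_index: "i < n \<Longrightarrow> j < n \<Longrightarrow> (P * U_perp n \<pi>) $$ (i, j) = P $$ (i, j) - \<pi> $ j"
proof -
  assume ij: "i < n" "j < n"
  have "(P * U_perp n \<pi>) $$ (i, j) = (\<Sum>h<n. P $$ (i, h) * U_perp n \<pi> $$ (h, j))"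
    using ij by (intro index_mult_mat_sum) (auto simp: U_perp_def ones_pi_def)
  also have "\<dots> = (\<Sum>h<n. (if h = j then P $$ (i, h) else 0) - P $$ (i, h) * \<pi> $ j)"
    using ij by (intro sum.cong) (auto simp: U_perp_def ones_pi_def algebra_simps)
  also have "\<dots> = P $$ (i, j) - (\<Sum>h<n. P $$ (i, h)) * \<pi> $ j"
    using ij by (simp add: sum_subtractf sum_distrib_right)
  finally show ?thesis using ij stochastic by (simp add: row_stochastic_def)
qed

lemma weighted_PU_carrier [simp]: "weighted_PU n P \<pi> \<in> carrier_mat n n"
  unfolding weighted_PU_def by (intro mult_carrier_mat[of _ n n] PU_carrier) auto

lemma weighted_PU_index:
  assumes "i < n" "j < n"
  shows "weighted_PU n P \<pi> $$ (i, j) = sqrt (\<pi> $ i) * (P $$ (i, j) - \<pi> $ j) / sqrt (\<pi> $ j)"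
  unfolding weighted_PU_def
  by (subst mat_diag_mult_left[OF PU_carrier], subst mat_diag_mult_right[of _ n n])
    (use assms in \<open>auto simp: PU_index simp del: index_mult_mat\<close>)

text \<open>Positivity of \<pi> makes the two diagonal matrices mutually inverse. The similarity
  transfers diagonalizability from \<open>P * U_perp n \<pi>\<close> to the weighted matrix.\<close>

lemma similar_weighted_PU:
  "similar_mat (complex_mat (P * U_perp n \<pi>)) (complex_mat (weighted_PU n P \<pi>))"
proof -
  let ?D = "mat_diag n (\<lambda>i. sqrt (\<pi> $ i))" and ?E = "mat_diag n (\<lambda>i. 1 / sqrt (\<pi> $ i))"
  have inv: "?D * ?E = 1\<^sub>m n" "?E * ?D = 1\<^sub>m n"
    unfolding mat_diag_diag by (auto simp: mat_diag_def intro!: eq_matI dest!: pi_pos)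
  have D: "?D \<in> carrier_mat n n" and E: "?E \<in> carrier_mat n n" by simp_all
  have "similar_mat (complex_mat (weighted_PU n P \<pi>)) (complex_mat (P * U_perp n \<pi>))"
  proof (rule similar_matI)
    show "complex_mat ?D * complex_mat ?E = 1\<^sub>m n" "complex_mat ?E * complex_mat ?D = 1\<^sub>m n"
      unfolding of_real_hom.mat_hom_mult[OF D E, symmetric] of_real_hom.mat_hom_mult[OF E D, symmetric]
        inv of_real_hom.mat_hom_one by (rule refl)+
    show "complex_mat (weighted_PU n P \<pi>) =
        complex_mat ?D * complex_mat (P * U_perp n \<pi>) * complex_mat ?E"
      unfolding weighted_PU_def of_real_hom.mat_hom_mult[OF mult_carrier_mat[OF D PU_carrier] E]
        of_real_hom.mat_hom_mult[OF D PU_carrier] by (rule refl)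
  qed (use D E PU_carrier weighted_PU_carrier in simp)
  then show ?thesis by (rule similar_mat_sym)
qed

lemma weighted_PU_eigenvalue_less_1:
  assumes "irreducible_chain n P" "aperiodic_chain n P"
    and "eigenvalue (complex_mat (weighted_PU n P \<pi>)) l"
  shows "cmod l < 1"
proof (rule ccontr)
  assume "\<not> cmod l < 1"
  then have l: "1 \<le> cmod l" by simp
  obtain x where x: "x \<in> carrier_vec n" "x \<noteq> 0\<^sub>v n"
    and Mx: "complex_mat (weighted_PU n P \<pi>) *\<^sub>v x = l \<cdot>\<^sub>v x"
    using assms(3) carrier_matD[OF weighted_PU_carrier]
    by (auto simp: eigenvalue_def eigenvector_def)
  \<comment> \<open>Undoing the scaling by the square roots of the weights turns an eigenvector of
    the weighted matrix into one of \<open>P * U_perp n \<pi>\<close>.\<close>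
  define v where "v i = x $ i / complex_of_real (sqrt (\<pi> $ i))" for i
  have PU_v: "(\<Sum>j<n. complex_of_real (P $$ (i, j) - \<pi> $ j) * v j) = l * v i" if i: "i < n" for i
  proof -
    have "l * x $ i = (complex_mat (weighted_PU n P \<pi>) *\<^sub>v x) $ i"
      using i x(1) by (simp add: Mx)
    also have "\<dots> = (\<Sum>j<n. complex_mat (weighted_PU n P \<pi>) $$ (i, j) * x $ j)"
      using i x(1) by (intro index_mult_mat_vec_sum) auto
    also have "\<dots> = (\<Sum>j<n. complex_of_real (sqrt (\<pi> $ i)) *
        (complex_of_real (P $$ (i, j) - \<pi> $ j) * v j))"
      using i carrier_matD[OF weighted_PU_carrier]
      by (intro sum.cong) (auto simp: weighted_PU_index v_def)
    finally have "l * x $ i = complex_of_real (sqrt (\<pi> $ i)) *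
        (\<Sum>j<n. complex_of_real (P $$ (i, j) - \<pi> $ j) * v j)"
      by (simp add: sum_distrib_left)
    then show ?thesis using pi_pos[OF i] by (simp add: v_def field_simps)
  qed
  \<comment> \<open>Averaging the eigenvalue equation against \<pi>: invariance makes \<pi> a left
    null vector of \<open>P * U_perp n \<pi>\<close>, and \<open>l\<close> is nonzero, so
    \<open>v\<close> has mean zero.\<close>
  have "l * (\<Sum>i<n. complex_of_real (\<pi> $ i) * v i) =
      (\<Sum>i<n. complex_of_real (\<pi> $ i) * (l * v i))"
    by (simp add: sum_distrib_left mult.left_commute)
  also have "\<dots> = (\<Sum>i<n. \<Sum>j<n. complex_of_real (\<pi> $ i * (P $$ (i, j) - \<pi> $ j)) * v j)"
    by (intro sum.cong) (auto simp: PU_v[symmetric] sum_distrib_left mult.assoc)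
  also have "\<dots> = (\<Sum>j<n. complex_of_real (\<Sum>i<n. \<pi> $ i * (P $$ (i, j) - \<pi> $ j)) * v j)"
    by (subst sum.swap) (simp add: sum_distrib_right)
  also have "\<dots> = 0"
    by (intro sum.neutral)
      (auto simp: right_diff_distrib sum_subtractf sum_distrib_right[symmetric] pi_invariant sum_pi)
  finally have mean: "(\<Sum>i<n. complex_of_real (\<pi> $ i) * v i) = 0"
    using l by auto
  \<comment> \<open>With mean zero the rank-one correction drops out, and \<open>v\<close> is an
    eigenfunction of \<open>P\<close> itself.\<close>
  have "(\<Sum>j<n. complex_of_real (P $$ (i, j)) * v j) = l * v i" if "i < n" for i
    using PU_v[OF that] mean by (simp add: left_diff_distrib sum_subtractf)
  from ergodic_peripheral_eigenfunction_constant[OF stochastic assms(1,2) this l]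
  obtain c where c: "\<And>j. j < n \<Longrightarrow> v j = c" by blast
  have "(\<Sum>i<n. complex_of_real (\<pi> $ i) * v i) = complex_of_real (\<Sum>i<n. \<pi> $ i) * c"
    by (simp add: c sum_distrib_right)
  then have "c = 0" using mean by (simp add: sum_pi)
  then have "x $ i = 0" if "i < n" for i
    using c[OF that] pi_pos[OF that] by (simp add: v_def)
  then show False using x by (auto intro!: eq_vecI)
qed

section \<open>Translating the decay of the chain into powers of the weighted matrix\<close>

definition weight_vec :: "real vec \<Rightarrow> complex vec" where
  "weight_vec g = vec n (\<lambda>i. complex_of_real (sqrt (\<pi> $ i) * g $ i))"

text \<open>\<open>weight_vec\<close> is D^(1/2) followed by the embedding into complex vectors,
  where \<open>S\<close> and \<open>T\<close> act; squaring the factor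
  \<open>sqrt (\<pi> $ i)\<close> produces exactly the weight.\<close>

lemma euclid_norm_weight_vec: "euclid_norm (weight_vec g) = l2pi_norm \<pi> g"
proof -
  have "(cmod (complex_of_real (sqrt (\<pi> $ i) * g $ i)))\<^sup>2 = \<bar>g $ i\<bar>\<^sup>2 * \<pi> $ i" if "i < n" for i
    unfolding norm_of_real using pi_pos[OF that] by (simp add: power_mult_distrib)
  then show ?thesis by (simp add: euclid_norm_def weight_vec_def l2pi_norm_def)
qed

text \<open>On mean-zero functions \<open>weight_vec\<close> intertwines \<open>P\<close> with the
  weighted matrix. Invariance of \<pi> keeps \<open>P *\<^sub>v g\<close> mean-zero, so the single
  step can be iterated.\<close>

lemma weighted_PU_pow_weight_vec:
  assumes "g \<in> carrier_vec n" "(\<Sum>i<n. \<pi> $ i * g $ i) = 0"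
  shows "complex_mat (weighted_PU n P \<pi>) ^\<^sub>m k *\<^sub>v weight_vec g = weight_vec (P ^\<^sub>m k *\<^sub>v g)"
  using assms
proof (induction k arbitrary: g)
  case 0
  then show ?case
    using carrier_matD[OF P_carrier] carrier_matD[OF weighted_PU_carrier]
    by (simp add: weight_vec_def)
next
  case (Suc k)
  let ?M = "complex_mat (weighted_PU n P \<pi>)"
  have M: "?M \<in> carrier_mat n n" and wg: "weight_vec g \<in> carrier_vec n"
    by (auto simp: weight_vec_def)
  have Pg: "P *\<^sub>v g \<in> carrier_vec n"
    "\<And>i. i < n \<Longrightarrow> (P *\<^sub>v g) $ i = (\<Sum>j<n. P $$ (i, j) * g $ j)"
    using Suc.prems mult_mat_vec_carrier[OF P_carrier] index_mult_mat_vec_sum[OF P_carrier]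
    by auto
  have step: "?M *\<^sub>v weight_vec g = weight_vec (P *\<^sub>v g)"
  proof (rule eq_vecI)
    fix i assume "i < dim_vec (weight_vec (P *\<^sub>v g))"
    then have i: "i < n" by (simp add: weight_vec_def)
    have "(?M *\<^sub>v weight_vec g) $ i = (\<Sum>j<n. ?M $$ (i, j) * weight_vec g $ j)"
      by (rule index_mult_mat_vec_sum[OF M wg i])
    also have "\<dots> = (\<Sum>j<n. complex_of_real (sqrt (\<pi> $ i) * (P $$ (i, j) * g $ j - \<pi> $ j * g $ j)))"
    proof (intro sum.cong refl)
      fix j assume "j \<in> {..<n}"
      then show "?M $$ (i, j) * weight_vec g $ j =
          complex_of_real (sqrt (\<pi> $ i) * (P $$ (i, j) * g $ j - \<pi> $ j * g $ j))"
        using i pi_pos[of j] carrier_matD[OF weighted_PU_carrier]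
        by (auto simp: weighted_PU_index weight_vec_def field_simps)
    qed
    also have "\<dots> = weight_vec (P *\<^sub>v g) $ i"
      using i Suc.prems(2)
      by (simp add: weight_vec_def Pg(2) sum_distrib_left[symmetric] sum_subtractf
          del: index_mult_mat_vec of_real_mult of_real_diff flip: of_real_sum)
    finally show "(?M *\<^sub>v weight_vec g) $ i = weight_vec (P *\<^sub>v g) $ i" .
  qed (use carrier_matD[OF M] in \<open>auto simp: weight_vec_def\<close>)
  have "(\<Sum>i<n. \<pi> $ i * (P *\<^sub>v g) $ i) = (\<Sum>i<n. \<Sum>j<n. \<pi> $ i * P $$ (i, j) * g $ j)"
    by (intro sum.cong) (auto simp: Pg(2) sum_distrib_left mult.assoc simp del: index_mult_mat_vec)
  also have "\<dots> = (\<Sum>j<n. (\<Sum>i<n. \<pi> $ i * P $$ (i, j)) * g $ j)"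
    by (subst sum.swap) (simp add: sum_distrib_right)
  also have "\<dots> = 0" using Suc.prems(2) by (simp add: pi_invariant)
  finally have mean: "(\<Sum>i<n. \<pi> $ i * (P *\<^sub>v g) $ i) = 0" .
  \<comment> \<open>A matrix power splits off its last factor, which acts on the vector first; hence
    the induction hypothesis is used at \<open>P *\<^sub>v g\<close>.\<close>
  have "?M ^\<^sub>m Suc k *\<^sub>v weight_vec g = ?M ^\<^sub>m k *\<^sub>v weight_vec (P *\<^sub>v g)"
    using assoc_mult_mat_vec[OF pow_carrier_mat[OF M] M wg] by (simp add: step)
  also have "\<dots> = weight_vec (P ^\<^sub>m k *\<^sub>v (P *\<^sub>v g))" by (rule Suc.IH[OF Pg(1) mean])
  also have "P ^\<^sub>m k *\<^sub>v (P *\<^sub>v g) = P ^\<^sub>m Suc k *\<^sub>v g"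
    using assoc_mult_mat_vec[OF pow_carrier_mat[OF P_carrier] P_carrier Suc.prems(1)] by simp
  finally show ?case .
qed

text \<open>Powers of \<open>P\<close> have row sums 1 and therefore fix the constant vector
  \<open>pi_mean \<pi> f\<close>.\<close>

lemma pow_minus_pi_mean:
  assumes "f \<in> carrier_vec n"
  shows "P ^\<^sub>m k *\<^sub>v f - pi_mean \<pi> f = P ^\<^sub>m k *\<^sub>v (f - pi_mean \<pi> f)"
proof -
  have C: "P ^\<^sub>m k \<in> carrier_mat n n" "pi_mean \<pi> f \<in> carrier_vec n"
    by (auto simp: pi_mean_def)
  have "P ^\<^sub>m k *\<^sub>v pi_mean \<pi> f = pi_mean \<pi> f"
  proof (rule eq_vecI)
    fix i assume "i < dim_vec (pi_mean \<pi> f)"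
    then have i: "i < n" by (simp add: pi_mean_def)
    have "(P ^\<^sub>m k *\<^sub>v pi_mean \<pi> f) $ i = (\<Sum>j<n. (P ^\<^sub>m k) $$ (i, j) * pi_mean \<pi> f $ j)"
      by (rule index_mult_mat_vec_sum[OF C i])
    also have "\<dots> = (\<Sum>j<n. (P ^\<^sub>m k) $$ (i, j)) * pi_mean \<pi> f $ i"
      unfolding sum_distrib_right using i by (intro sum.cong) (auto simp: pi_mean_def)
    also have "\<dots> = pi_mean \<pi> f $ i"
      using row_stochastic_pow[OF stochastic, of k] i by (simp add: row_stochastic_def)
    finally show "(P ^\<^sub>m k *\<^sub>v pi_mean \<pi> f) $ i = pi_mean \<pi> f $ i" .
  qed (use C carrier_matD[OF P_carrier] in auto)
  then show ?thesis using mult_minus_distrib_mat_vec[OF C(1) assms C(2)] by simp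
qed

lemma sum_pi_minus_pi_mean:
  assumes "f \<in> carrier_vec n"
  shows "(\<Sum>i<n. \<pi> $ i * (f - pi_mean \<pi> f) $ i) = 0"
proof -
  define c where "c = (\<Sum>i<n. \<pi> $ i * f $ i)"
  have "(\<Sum>i<n. \<pi> $ i * (f - pi_mean \<pi> f) $ i) = (\<Sum>i<n. \<pi> $ i * f $ i - \<pi> $ i * c)"
    by (intro sum.cong) (auto simp: pi_mean_def c_def algebra_simps)
  also have "\<dots> = c - (\<Sum>i<n. \<pi> $ i) * c"
    by (simp add: sum_subtractf sum_distrib_right c_def)
  finally show ?thesis by (simp add: sum_pi)
qed

text \<open>The functions tested by the supremum, once centred, become real unit vectors under
  \<open>weight_vec\<close>, so an operator bound over all complex vectors covers them.\<close>

lemma l2pi_decay_le: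
  assumes "\<And>x. x \<in> carrier_vec n \<Longrightarrow>
    euclid_norm (complex_mat (weighted_PU n P \<pi>) ^\<^sub>m k *\<^sub>v x) \<le> b * euclid_norm x"
  shows "l2pi_decay P \<pi> k \<le> ereal b"
  unfolding l2pi_decay_def
proof (rule SUP_least)
  fix f assume "f \<in> {f \<in> carrier_vec (dim_vec \<pi>). l2pi_norm \<pi> (f - pi_mean \<pi> f) = 1}"
  then have f: "f \<in> carrier_vec n" "l2pi_norm \<pi> (f - pi_mean \<pi> f) = 1" by auto
  define g where "g = f - pi_mean \<pi> f"
  have g: "g \<in> carrier_vec n" using f(1) by (auto simp: g_def pi_mean_def)
  have "weight_vec (P ^\<^sub>m k *\<^sub>v g) = complex_mat (weighted_PU n P \<pi>) ^\<^sub>m k *\<^sub>v weight_vec g"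
    using weighted_PU_pow_weight_vec[OF g] sum_pi_minus_pi_mean[OF f(1)] by (simp add: g_def)
  then have "l2pi_norm \<pi> (P ^\<^sub>m k *\<^sub>v g) \<le> b * euclid_norm (weight_vec g)"
    unfolding euclid_norm_weight_vec[symmetric] using assms[of "weight_vec g"]
    by (simp add: weight_vec_def)
  also have "\<dots> = b" using f(2) by (simp add: euclid_norm_weight_vec g_def)
  finally show "ereal (l2pi_norm \<pi> (P ^\<^sub>m k *\<^sub>v f - pi_mean \<pi> f)) \<le> ereal b"
    using pow_minus_pi_mean[OF f(1)] by (simp add: g_def)
qed

text \<open>The scaling factors are nonzero, so each entry of \<open>P\<close> must equal the one
  subtracted. This identifies the degenerate chain behind a vanishing spectral radius.\<close>

lemma eq_ones_pi_if_weighted_PU_eq_0: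
  assumes "complex_mat (weighted_PU n P \<pi>) = 0\<^sub>m n n"
  shows "P = ones_pi n \<pi>"
proof (rule eq_matI)
  fix i j assume "i < dim_row (ones_pi n \<pi>)" "j < dim_col (ones_pi n \<pi>)"
  then have ij: "i < n" "j < n" by (auto simp: ones_pi_def)
  have "complex_of_real (weighted_PU n P \<pi> $$ (i, j)) = 0"
    using arg_cong[OF assms, of "\<lambda>A. A $$ (i, j)"] ij carrier_matD[OF weighted_PU_carrier] by simp
  then show "P $$ (i, j) = ones_pi n \<pi> $$ (i, j)"
    using ij pi_pos[of i] pi_pos[of j] by (auto simp: weighted_PU_index ones_pi_def)
qed (use carrier_matD[OF P_carrier] in \<open>auto simp: ones_pi_def\<close>)

end

text \<open>\<open>hypocoercive_with\<close> demands a strictly positive rate, whereas for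
  \<open>P = ones_pi n \<pi>\<close> the weighted matrix is zero and \<open>\<rho> = 0\<close>. The
  guard covers this case only; the decay bound holds there as well.\<close>

theorem mainTheorem8:
  fixes n :: nat and P :: "real mat" and \<pi> :: "real vec"
    and S T :: "complex mat" and n_as :: "(nat \<times> complex) list"
    and \<rho> :: real and \<kappa> :: ereal
  assumes "row_stochastic n P"
    and "irreducible_chain n P"
    and "aperiodic_chain n P"
    and "positive_stationary n P \<pi>"
    and "diagonalizable (complex_mat (P * U_perp n \<pi>))"
    and "\<rho> = spectral_radius (complex_mat (weighted_PU n P \<pi>))"
    and "jordan_nf (complex_mat (weighted_PU n P \<pi>)) n_as"
    and "similar_mat_wit (complex_mat (weighted_PU n P \<pi>)) (jordan_matrix n_as) S T"
    and "\<kappa> = cond_number S T"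
  shows "(P \<noteq> ones_pi n \<pi> \<longrightarrow> hypocoercive_with P \<pi> \<kappa> \<rho>) \<and>
    \<kappa> < \<infinity> \<and> 0 \<le> \<rho> \<and> \<rho> < 1 \<and>
    (\<forall>k\<ge>1. l2pi_decay P \<pi> k \<le> \<kappa> * ereal (\<rho> ^ k))"
proof -
  interpret stationary_chain n P \<pi>
    using assms(1,4) by unfold_locales
  define M where "M = complex_mat (weighted_PU n P \<pi>)"
  have M: "M \<in> carrier_mat n n" by (simp add: M_def)
  note wit = similar_mat_witD2[OF M assms(8)[folded M_def]]
  note jnf = assms(7)[folded M_def]
  define as where "as = map snd n_as"
  have n_as: "n_as = map (Pair 1) as"
    using jordan_nf_diagonalizable[OF jnf] diagonalizable_similar[OF similar_weighted_PU assms(5)]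
    by (simp add: as_def M_def)
  have J: "jordan_matrix n_as = mat_diag (length as) ((!) as)"
    unfolding n_as by (rule jordan_matrix_singletons)
  have len: "length as = n" using wit(5) by (auto simp: J mat_diag_def)
  have rho_mem: "\<rho> \<in> norm ` spectrum M"
    and rho_max: "\<And>l. eigenvalue M l \<Longrightarrow> cmod l \<le> \<rho>"
    using spectral_radius_mem_max[OF M n_pos] assms(6) by (auto simp: M_def spectrum_def)
  \<comment> \<open>The spectral radius is attained by an eigenvalue, so the strict bound on
    eigenvalues passes to \<rho>.\<close>
  have rho: "0 \<le> \<rho>" "\<rho> < 1"
    using rho_mem weighted_PU_eigenvalue_less_1[OF assms(2,3)] by (auto simp: M_def spectrum_def)
  \<comment> \<open>Each diagonal entry of the Jordan matrix is an eigenvalue of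
    \<open>M\<close>.\<close>
  have as_le: "cmod (as ! i) \<le> \<rho>" if "i < n" for i
    using that len by (intro rho_max eigenvalue_jordan_nf[OF M jnf, of 1]) (auto simp: n_as)
  obtain s where s: "spectral_norm S = ereal s" "0 \<le> s"
    "\<And>x. x \<in> carrier_vec n \<Longrightarrow> euclid_norm (S *\<^sub>v x) \<le> s * euclid_norm x"
    using spectral_norm_real[OF wit(6) n_pos] by blast
  obtain t where t: "spectral_norm T = ereal t" "0 \<le> t"
    "\<And>x. x \<in> carrier_vec n \<Longrightarrow> euclid_norm (T *\<^sub>v x) \<le> t * euclid_norm x"
    using spectral_norm_real[OF wit(7) n_pos] by blast
  have kappa: "\<kappa> = ereal (s * t)"
    using assms(9) s(1) t(1) by (simp add: cond_number_def)
  have decay: "l2pi_decay P \<pi> k \<le> \<kappa> * ereal (\<rho> ^ k)" for k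
  proof -
    let ?E = "mat_diag n (\<lambda>i. as ! i ^ k)"
    have E: "?E \<in> carrier_mat n n" by simp
    \<comment> \<open>The inner factors \<open>T * S\<close> cancel, so \<open>S\<close> and
      \<open>T\<close> contribute their norms only once, whatever \<open>k\<close> is.\<close>
    have Mk: "M ^\<^sub>m k = S * ?E * T"
      using similar_mat_wit_pow_id[OF assms(8)[folded M_def], of k] by (simp add: J len mat_diag_pow)
    have "euclid_norm (M ^\<^sub>m k *\<^sub>v x) \<le> s * t * \<rho> ^ k * euclid_norm x"
      if x: "x \<in> carrier_vec n" for x
    proof -
      have Tx: "T *\<^sub>v x \<in> carrier_vec n" using wit(7) x by simp
      have ETx: "?E *\<^sub>v (T *\<^sub>v x) \<in> carrier_vec n" using E Tx by (rule mult_mat_vec_carrier)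
      have "M ^\<^sub>m k *\<^sub>v x = S *\<^sub>v (?E *\<^sub>v (T *\<^sub>v x))"
        unfolding Mk using assoc_mult_mat_vec[OF mult_carrier_mat[OF wit(6) E] wit(7) x]
          assoc_mult_mat_vec[OF wit(6) E Tx] by simp
      also have "euclid_norm \<dots> \<le> s * euclid_norm (?E *\<^sub>v (T *\<^sub>v x))" by (rule s(3)[OF ETx])
      also have "\<dots> \<le> s * (\<rho> ^ k * euclid_norm (T *\<^sub>v x))"
        using rho(1) as_le
        by (intro mult_left_mono s(2) euclid_norm_mat_diag_le[OF Tx])
          (auto simp: norm_power intro: power_mono)
      also have "\<dots> \<le> s * (\<rho> ^ k * (t * euclid_norm x))"
        using rho(1) by (intro mult_left_mono s(2) t(3)[OF x]) auto
      finally show ?thesis by (simp add: mult_ac)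
    qed
    then show ?thesis unfolding M_def kappa using l2pi_decay_le[of k "s * t * \<rho> ^ k"] by simp
  qed
  have "0 < \<rho>" if "P \<noteq> ones_pi n \<pi>"
  proof (rule ccontr)
    assume "\<not> 0 < \<rho>"
    \<comment> \<open>If \<rho> vanishes, so does every diagonal entry, and with the Jordan matrix
      also \<open>M\<close>.\<close>
    then have "as ! i = 0" if "i < n" for i using as_le[OF that] rho(1) by simp
    then have "jordan_matrix n_as = 0\<^sub>m n n" unfolding J len by (auto simp: mat_diag_def)
    then have "M = 0\<^sub>m n n" using wit(3,6,7) by simp
    then show False using that eq_ones_pi_if_weighted_PU_eq_0 by (simp add: M_def)
  qed
  then show ?thesis using rho decay kappa by (auto simp: hypocoercive_with_def)
qed

end
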